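(* For $n\geq 2$, call a set $\{x_1,\dots,x_n\}$ of $n$ pairwise distinct positive integers admissible if $\sum_{i=1}^n 1/x_i=1$ and there is an odd prime $q$ such that every $x_i$ is of the form $2^{a_i}q^{b_i}$ with $a_i\in\{0,1,2\}$, $b_i\geq 0$. For $n=10,11,12,13$ the number of admissible sets is respectively $101$, $192$, $363$, $692$. Of these, respectively $100$, $190$, $362$, $690$ have $q=3$. The remaining ones are: for each $n\in\{10,11,12,13\}$ the set $U_n=\{2,2^2,5,5^2,\dots,5^{n-3},2^2\cdot 5^{n-3}\}$ (with $q=5$), and, for $n\in\{11,13\}$ only, the set $V_n=\{2,2^2,7,2\cdot 7,7^2,2\cdot 7^2,\dots,7^{\frac{n-5}{2}},2\cdot 7^{\frac{n-5}{2}},7^{\frac{n-3}{2}},2\cdot 7^{\frac{n-3}{2}},2^2\cdot 7^{\frac{n-3}{2}}\}$ (with $q=7$).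
   Context: Solutions are counted as unordered sets; the same odd prime $q$ is used for all entries of a given set. *)

theory Defs
  imports Complex_Main "HOL-Computational_Algebra.Primes"
begin

definition admissible_with :: "nat \<Rightarrow> nat \<Rightarrow> nat set \<Rightarrow> bool" where
  "admissible_with q n X \<longleftrightarrow>
     n \<ge> 2 \<and> prime q \<and> odd q \<and>
     finite X \<and> card X = n \<and>
     (\<forall>x\<in>X. x > 0) \<and>
     (\<Sum>x\<in>X. 1 / of_nat x) = (1::rat) \<and>
     (\<forall>x\<in>X. \<exists>a b. a \<in> {0, 1, 2} \<and> x = 2 ^ a * q ^ b)"

definition admissible :: "nat \<Rightarrow> nat set \<Rightarrow> bool" where
  "admissible n X \<longleftrightarrow> (\<exists>q. admissible_with q n X)"

definition U :: "nat \<Rightarrow> nat set" where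
  "U n = {2, 2^2} \<union> {5 ^ k | k. 1 \<le> k \<and> k \<le> n - 3} \<union> {2^2 * 5 ^ (n - 3)}"

(* Only used for odd n, where the division by 2 is exact. *)
definition V :: "nat \<Rightarrow> nat set" where
  "V n = {2, 2^2} \<union> {7 ^ k | k. 1 \<le> k \<and> k \<le> (n - 3) div 2}
         \<union> {2 * 7 ^ k | k. 1 \<le> k \<and> k \<le> (n - 3) div 2}
         \<union> {2^2 * 7 ^ ((n - 3) div 2)}"

end

theory Submission
  imports Defs
begin

text \<open>
  A finite set of numbers $2^a q^b$ with $a \le 2$ is a sequence of subsets of $\{1, 2, 4\}$, one for
  each exponent $b$. Splitting off the elements with $b = 0$, of total reciprocal sum $w/4$, and
  dividing the others by $q$ turns a set with reciprocal sum $s/4$ into one with reciprocal sum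
  $q(s - w)/4$. The reciprocals of all numbers of this form sum to $7q / (4(q - 1))$, so from
  $s = 4$ only finitely many values of $s$ can be reached: $3, 6, 9$ for $q = 3$, a single
  value $q$ for $q = 5, 7$, and none for $q \ge 11$. The numbers of sets of given size
  therefore satisfy small linear recurrences.
\<close>

section \<open>Smooth numbers and sets with prescribed reciprocal sum\<close>

definition smooth :: "nat \<Rightarrow> nat \<Rightarrow> bool" where
  "smooth q x \<longleftrightarrow> (\<exists>a b. a \<in> {0, 1, 2} \<and> x = 2 ^ a * q ^ b)"

definition recip_sum :: "nat set \<Rightarrow> rat" where
  "recip_sum X = (\<Sum>x\<in>X. 1 / of_nat x)"

text \<open>The target is counted in quarters, the common unit of 1, 1/2 and 1/4, so that
  \<open>s\<close> stays a natural number throughout the recursion; sum 1 is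
  \<open>s = 4\<close>.\<close>

definition reps :: "nat \<Rightarrow> nat \<Rightarrow> nat \<Rightarrow> nat set set" where
  "reps q s n = {X. finite X \<and> card X = n \<and> (\<forall>x\<in>X. smooth q x) \<and> recip_sum X = of_nat s / 4}"

text \<open>Meant for subsets of {1, 2, 4}, where the division is exact: the reciprocal sum in
  quarters.\<close>

definition weight :: "nat set \<Rightarrow> nat" where
  "weight D = (\<Sum>x\<in>D. 4 div x)"

lemma smooth_pos: "smooth q x \<Longrightarrow> q > 0 \<Longrightarrow> x > 0"
  by (auto simp: smooth_def)

lemma admissible_with_iff:
  "admissible_with q n X \<longleftrightarrow> n \<ge> 2 \<and> prime q \<and> odd q \<and> X \<in> reps q 4 n"
proof -
  have "(\<forall>x\<in>X. x > 0) \<and> (\<forall>x\<in>X. smooth q x) \<longleftrightarrow> (\<forall>x\<in>X. smooth q x)" if "prime q"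
    using smooth_pos prime_gt_0_nat[OF that] by blast
  then show ?thesis
    unfolding admissible_with_def reps_def recip_sum_def smooth_def[symmetric] by auto
qed

section \<open>Splitting off the elements with exponent b = 0\<close>

lemma smooth_cases:
  assumes "q > 0"
  shows "smooth q x \<longleftrightarrow> x \<in> {1, 2, 4} \<or> (\<exists>y. smooth q y \<and> x = q * y)"
proof
  assume "smooth q x"
  then obtain a b where ab: "a \<in> {0, 1, 2}" "x = 2 ^ a * q ^ b"
    by (auto simp: smooth_def)
  show "x \<in> {1, 2, 4} \<or> (\<exists>y. smooth q y \<and> x = q * y)"
  proof (cases b)
    case 0
    with ab show ?thesis by auto
  next
    case (Suc c)
    with ab have "smooth q (2 ^ a * q ^ c)" "x = q * (2 ^ a * q ^ c)"
      by (auto simp: smooth_def)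
    then show ?thesis by blast
  qed
next
  have "smooth q (2 ^ a * q ^ b)" if "a \<in> {0, 1, 2}" for a b
    using that by (auto simp: smooth_def)
  from this[of 0 0] this[of 1 0] this[of 2 0]
  have "smooth q 1" "smooth q 2" "smooth q 4" by simp_all
  moreover have "smooth q (q * y)" if "smooth q y" for y
  proof -
    from that obtain a b where "a \<in> {0, 1, 2}" "y = 2 ^ a * q ^ b"
      by (auto simp: smooth_def)
    then have "a \<in> {0, 1, 2}" "q * y = 2 ^ a * q ^ Suc b" by simp_all
    then show ?thesis unfolding smooth_def by blast
  qed
  moreover assume "x \<in> {1, 2, 4} \<or> (\<exists>y. smooth q y \<and> x = q * y)"
  ultimately show "smooth q x" by auto
qed

text \<open>An odd \<open>q > 1\<close> divides no power of 2. This keeps the layer inside {1, 2, 4}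
  disjoint from the multiples of \<open>q\<close>, so that the splitting of a set is unique.\<close>

lemma mult_odd_notin:
  fixes q y :: nat
  assumes "odd q" "q > 1"
  shows "q * y \<notin> {1, 2, 4}"
proof
  assume "q * y \<in> {1, 2, 4}"
  then have "q * y = 2 ^ 0 \<or> q * y = 2 ^ 1 \<or> q * y = 2 ^ 2" by simp
  then obtain k :: nat where "q * y = 2 ^ k" by blast
  then have "q dvd 2 ^ k" by (metis dvd_triv_left)
  moreover from \<open>odd q\<close> have "coprime q (2 ^ k)" by simp
  ultimately show False using \<open>q > 1\<close> by (metis coprime_absorb_left nat_dvd_1_iff_1 less_irrefl)
qed

lemma recip_sum_weight:
  assumes "D \<subseteq> {1, 2, 4}"
  shows "recip_sum D = of_nat (weight D) / 4"
proof -
  have "recip_sum D = (\<Sum>x\<in>D. of_nat (4 div x) / 4)"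
    unfolding recip_sum_def using assms by (intro sum.cong) auto
  then show ?thesis by (simp add: weight_def sum_divide_distrib)
qed

lemma recip_sum_mult:
  assumes "q > 0"
  shows "recip_sum ((*) q ` X) = recip_sum X / of_nat q"
  using assms
  by (simp add: recip_sum_def sum.reindex inj_on_def sum_divide_distrib mult.commute)

lemma recip_sum_nonneg: "recip_sum X \<ge> 0"
  by (simp add: recip_sum_def sum_nonneg)

text \<open>\<open>D\<close> is the layer b = 0, and \<open>X\<close> on the right is the rest
  divided by \<open>q\<close>, which multiplies its reciprocal sum by \<open>q\<close>. What remains
  after \<open>D\<close> is \<open>s - weight D\<close> quarters, hence the new target
  \<open>q * (s - weight D)\<close>.\<close>

lemma reps_rec:
  assumes "odd q" "q > 1"
  shows "reps q s n =
    (\<Union>D\<in>{D\<in>Pow {1, 2, 4}. weight D \<le> s \<and> card D \<le> n}.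
       (\<lambda>X. D \<union> (*) q ` X) ` reps q (q * (s - weight D)) (n - card D))"
    (is "_ = (\<Union>D\<in>?I. ?F D ` _)")
proof (intro equalityI subsetI)
  fix X assume X: "X \<in> reps q s n"
  define D where "D = X \<inter> {1, 2, 4}"
  define Y where "Y = {y. q * y \<in> X}"
  have inj: "inj ((*) q)" using assms by (auto simp: inj_def)
  have eq: "X = D \<union> (*) q ` Y"
  proof (intro equalityI subsetI)
    fix x assume "x \<in> X"
    then have "smooth q x" using X by (auto simp: reps_def)
    then have "x \<in> {1, 2, 4} \<or> (\<exists>y. smooth q y \<and> x = q * y)"
      by (subst (asm) smooth_cases) (use assms in simp_all)
    with \<open>x \<in> X\<close> show "x \<in> D \<union> (*) q ` Y"
      by (auto simp: D_def Y_def)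
  qed (auto simp: D_def Y_def)
  have disj: "D \<inter> (*) q ` Y = {}"
    using mult_odd_notin[OF assms] by (auto simp: D_def)
  have fin: "finite D" "finite Y"
    using X finite_vimageI[OF _ inj, of X] by (auto simp: D_def Y_def reps_def vimage_def)
  have "n = card D + card Y"
    using X eq disj fin card_Un_disjoint[of D "(*) q ` Y"] inj
    by (auto simp: reps_def card_image inj_on_subset)
  moreover have sum: "of_nat s / 4 = of_nat (weight D) / 4 + recip_sum Y / of_nat q"
  proof -
    have "of_nat s / 4 = recip_sum (D \<union> (*) q ` Y)" using X eq by (simp add: reps_def)
    also have "\<dots> = recip_sum D + recip_sum ((*) q ` Y)"
      using disj fin by (auto simp: recip_sum_def intro!: sum.union_disjoint)
    finally show ?thesis
      using assms by (simp add: recip_sum_mult recip_sum_weight D_def)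
  qed
  \<comment> \<open>This ensures that the natural subtraction \<open>s - weight D\<close> does not
    truncate.\<close>
  moreover have le: "weight D \<le> s"
  proof -
    have "recip_sum Y / of_nat q \<ge> 0" using recip_sum_nonneg by simp
    with sum have "(of_nat (weight D) :: rat) \<le> of_nat s" by linarith
    then show ?thesis by simp
  qed
  moreover have "recip_sum Y = of_nat (q * (s - weight D)) / 4"
    using sum le assms by (simp add: of_nat_diff field_simps)
  moreover have "\<forall>y\<in>Y. smooth q y"
  proof
    fix y assume "y \<in> Y"
    then have "smooth q (q * y)" using X by (auto simp: Y_def reps_def)
    then have "q * y \<in> {1, 2, 4} \<or> (\<exists>z. smooth q z \<and> q * y = q * z)"
      by (subst (asm) smooth_cases) (use assms in simp_all)
    then show "smooth q y"
      using assms mult_odd_notin[OF assms, of y] by simp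
  qed
  ultimately have "D \<in> ?I" "Y \<in> reps q (q * (s - weight D)) (n - card D)"
    using fin by (auto simp: reps_def D_def)
  with eq show "X \<in> (\<Union>D\<in>?I. ?F D ` reps q (q * (s - weight D)) (n - card D))"
    by blast
next
  fix X assume "X \<in> (\<Union>D\<in>?I. ?F D ` reps q (q * (s - weight D)) (n - card D))"
  then obtain D Y where D: "D \<subseteq> {1, 2, 4}" "weight D \<le> s" "card D \<le> n"
    and Y: "Y \<in> reps q (q * (s - weight D)) (n - card D)" and eq: "X = D \<union> (*) q ` Y"
    by auto
  have fin: "finite D" "finite Y"
    using D Y finite_subset[of D "{1, 2, 4}"] by (auto simp: reps_def)
  have disj: "D \<inter> (*) q ` Y = {}"
    using mult_odd_notin[OF assms] D by blast
  have "card ((*) q ` Y) = card Y"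
    using assms by (intro card_image) (auto simp: inj_on_def)
  then have "card X = n"
    using eq disj fin D Y by (simp add: card_Un_disjoint reps_def)
  moreover have "recip_sum X = of_nat s / 4"
  proof -
    have "recip_sum X = recip_sum D + recip_sum ((*) q ` Y)"
      using disj fin eq by (auto simp: recip_sum_def intro!: sum.union_disjoint)
    also have "\<dots> = of_nat (weight D) / 4 + of_nat (s - weight D) / 4"
      using assms D Y by (simp add: recip_sum_mult recip_sum_weight reps_def)
    finally show ?thesis using D by (simp add: of_nat_diff field_simps)
  qed
  moreover have "\<forall>x\<in>X. smooth q x"
  proof
    fix x assume "x \<in> X"
    then have "x \<in> {1, 2, 4} \<or> (\<exists>y. smooth q y \<and> x = q * y)"
      using eq D Y by (auto simp: reps_def)
    then show "smooth q x"
      by (subst smooth_cases) (use assms in simp_all)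
  qed
  ultimately show "X \<in> reps q s n"
    using eq fin by (auto simp: reps_def)
qed

section \<open>Bounds on the target, and finiteness\<close>

text \<open>The exponent pairs of \<open>X\<close> lie in a finite box, whose reciprocals sum to (1
  + 1/2 + 1/4) times a partial geometric series. A partial sum stays strictly below the limit q/(q -
  1), which gives the strict inequality, stated with the denominator cleared.\<close>

lemma recip_sum_bound:
  assumes "finite X" "\<forall>x\<in>X. smooth q x" "q > 1"
  shows "recip_sum X * (of_nat q - 1) < 7 / 4 * of_nat q"
proof -
  have "\<exists>p. x = 2 ^ fst p * q ^ snd p \<and> fst p \<in> {0, 1, 2}" if "x \<in> X" for x
    using assms(2) that unfolding smooth_def by (metis fst_conv snd_conv)
  then obtain p where p: "\<And>x. x \<in> X \<Longrightarrow> x = 2 ^ fst (p x) * q ^ snd (p x) \<and> fst (p x) \<in> {0, 1, 2}"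
    by metis
  \<comment> \<open>\<open>m\<close> exceeds every exponent of \<open>q\<close> that occurs;
    inserting 0 keeps \<open>Max\<close> meaningful for empty \<open>X\<close>.\<close>
  define m where "m = Suc (Max (insert 0 ((\<lambda>x. snd (p x)) ` X)))"
  let ?g = "\<lambda>(a, b). 1 / of_nat (2 ^ a * q ^ b) :: rat"
  have "inj_on p X" by (rule inj_onI) (metis p)
  moreover have "p ` X \<subseteq> {0, 1, 2} \<times> {..<m}"
  proof
    fix y assume "y \<in> p ` X"
    then obtain x where x: "x \<in> X" "y = p x" by blast
    then have "snd y \<le> Max (insert 0 ((\<lambda>x. snd (p x)) ` X))"
      using assms(1) by (intro Max_ge) auto
    then show "y \<in> {0, 1, 2} \<times> {..<m}"
      using p[OF x(1)] x(2) by (simp add: m_def mem_Times_iff)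
  qed
  moreover have "recip_sum X = (\<Sum>x\<in>X. ?g (p x))"
    unfolding recip_sum_def
  proof (rule sum.cong)
    fix x assume "x \<in> X"
    from p[OF this] show "1 / of_nat x = ?g (p x)"
      by (metis (mono_tags, lifting) case_prod_beta)
  qed simp
  ultimately have "recip_sum X \<le> (\<Sum>y\<in>{0, 1, 2} \<times> {..<m}. ?g y)"
    by (auto simp: sum.reindex[of p, unfolded comp_def, symmetric] intro!: sum_mono2)
  also have "\<dots> = 7 / 4 * (\<Sum>b<m. (1 / of_nat q) ^ b)"
  proof -
    have "(\<Sum>y\<in>{0, 1, 2} \<times> {..<m}. ?g y) = (\<Sum>a\<in>{0, 1, 2}. \<Sum>b<m. ?g (a, b))"
      by (simp only: sum.cartesian_product case_prod_conv)
    also have "\<dots> = (\<Sum>a\<in>{0, 1, 2}. 1 / 2 ^ a * (\<Sum>b<m. (1 / of_nat q) ^ b))"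
      by (intro sum.cong refl) (simp add: sum_distrib_left power_one_over)
    finally show ?thesis by simp
  qed
  finally have "recip_sum X * (of_nat q - 1) \<le> 7 / 4 * (\<Sum>b<m. (1 / of_nat q) ^ b) * (of_nat q - 1)"
    using assms(3) by (intro mult_right_mono) auto
  also have "\<dots> = 7 / 4 * of_nat q * (1 - (1 / of_nat q) ^ m)"
  proof -
    have "(\<Sum>b<m. (1 / of_nat q) ^ b) * (of_nat q - 1) = (of_nat q * (1 - (1 / of_nat q) ^ m) :: rat)"
      using assms(3) by (induction m) (auto simp: field_simps)
    then show ?thesis by (simp add: mult.assoc)
  qed
  also have "\<dots> < 7 / 4 * of_nat q * 1"
    using assms(3) by (intro mult_strict_left_mono) auto
  finally show ?thesis by simp
qed

text \<open>Targets with s/4 at or above the unattained limit 7q/(4(q - 1)) are out of reach. This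
  is what leaves only finitely many targets in the recursion.\<close>

lemma reps_empty:
  assumes "q > 1" "7 * q \<le> s * (q - 1)"
  shows "reps q s n = {}"
proof (rule ccontr)
  assume "reps q s n \<noteq> {}"
  then obtain X where "X \<in> reps q s n" by blast
  then have "finite X" "\<forall>x\<in>X. smooth q x" and s: "recip_sum X = of_nat s / 4"
    by (auto simp: reps_def)
  from recip_sum_bound[OF this(1,2) assms(1)]
  have "(of_nat s / 4 * (of_nat q - 1) :: rat) < 7 / 4 * of_nat q" unfolding s .
  then have "(of_nat s * (of_nat q - 1) :: rat) < 7 * of_nat q" by simp
  then have "(of_nat (s * (q - 1)) :: rat) < of_nat (7 * q)"
    using assms(1) by (simp add: of_nat_diff)
  then have "s * (q - 1) < 7 * q" by (simp only: of_nat_less_iff)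
  with assms(2) show False by simp
qed

lemma reps_0:
  assumes "q > 0"
  shows "reps q 0 n = (if n = 0 then {{}} else {})"
proof -
  have "X = {}" if "X \<in> reps q 0 n" for X
  proof (rule ccontr)
    assume "X \<noteq> {}"
    with that have "recip_sum X > 0"
      unfolding recip_sum_def using smooth_pos[OF _ assms]
      by (intro sum_pos) (auto simp: reps_def)
    with that show False by (simp add: reps_def)
  qed
  then have "reps q 0 n \<subseteq> {{}}" by blast
  moreover have "{} \<in> reps q 0 n \<longleftrightarrow> n = 0" by (auto simp: reps_def recip_sum_def)
  ultimately show ?thesis by (cases "n = 0") auto
qed

text \<open>Induction along \<open>reps_rec\<close> on the lexicographic measure
  \<open>(n, 11 - s)\<close>: a nonempty layer lowers \<open>n\<close>, while the empty layer keeps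
  \<open>n\<close> and multiplies \<open>s\<close> by \<open>q\<close>, which lowers
  \<open>11 - s\<close> as long as 0 < s < 11.\<close>

lemma finite_reps:
  assumes "odd q" "q > 1"
  shows "finite (reps q s n)"
proof (induction "(n, 11 - s)" arbitrary: n s rule: wf_induct_rule[OF wf_lex_prod[OF wf_less_than wf_less_than]])
  case (1 n s)
  have q3: "q \<ge> 3" using assms by (auto elim!: oddE)
  consider "s = 0" | "s \<ge> 11" | "0 < s" "s < 11" by linarith
  then show ?case
  proof cases
    case 1
    then show ?thesis using assms by (simp add: reps_0)
  next
    case 2
    \<comment> \<open>Here 11 is the least integer above 21/2, the value of 7q/(q - 1) at q = 3,
      where it is largest.\<close>
    have "7 * q \<le> 11 * (q - 1)" using q3 by simp
    also have "\<dots> \<le> s * (q - 1)" using 2 by simp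
    finally show ?thesis using assms by (simp add: reps_empty)
  next
    case 3
    have "finite (reps q (q * (s - weight D)) (n - card D))"
      if D: "D \<in> Pow {1, 2, 4}" "card D \<le> n" for D
    proof (cases "D = {}")
      case True
      have "q * s \<ge> 3 * s" using q3 by simp
      with 3 have "11 - q * s < 11 - s" by linarith
      with True show ?thesis
        by (intro "1.hyps"[rule_format]) (auto simp: weight_def)
    next
      case False
      then have "card D > 0" using D finite_subset[of D "{1, 2, 4}"] by (auto simp: card_gt_0_iff)
      with D show ?thesis by (intro "1.hyps"[rule_format]) auto
    qed
    then show ?thesis by (subst reps_rec[OF assms]) auto
  qed
qed

section \<open>The recursion for the number of sets\<close>

lemma sum_Pow_insert:
  assumes "finite A" "x \<notin> A"
  shows "sum f (Pow (insert x A)) = sum f (Pow A) + (\<Sum>D\<in>Pow A. f (insert x D))"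
proof -
  have "inj_on (insert x) (Pow A)" using assms(2) by (auto simp: inj_on_def)
  then show ?thesis
    using assms by (subst Pow_insert, subst sum.union_disjoint) (auto simp: sum.reindex)
qed

text \<open>The pieces of \<open>reps_rec\<close> do not overlap: intersecting with {1, 2, 4}
  recovers \<open>D\<close>, and the preimage under multiplication by \<open>q\<close> recovers the
  rest, so cardinalities add up.\<close>

lemma card_reps_rec_Pow:
  assumes "odd q" "q > 1"
  shows "card (reps q s n) = (\<Sum>D\<in>Pow {1, 2, 4}. if weight D \<le> s \<and> card D \<le> n
           then card (reps q (q * (s - weight D)) (n - card D)) else 0)"
proof -
  let ?I = "{D \<in> Pow {1, 2, 4}. weight D \<le> s \<and> card D \<le> n}"
  let ?R = "\<lambda>D. reps q (q * (s - weight D)) (n - card D)"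
  let ?F = "\<lambda>D X. D \<union> (*) q ` X"
  have low: "?F D X \<inter> {1, 2, 4} = D" if "D \<subseteq> {1, 2, 4}" for D X
    using that mult_odd_notin[OF assms] by blast
  have high: "{y. q * y \<in> ?F D X} = X" if "D \<subseteq> {1, 2, 4}" for D X
    using that mult_odd_notin[OF assms] assms(2) by auto
  have "card (reps q s n) = card (\<Union>D\<in>?I. ?F D ` ?R D)"
    by (subst reps_rec[OF assms]) (rule refl)
  also have "\<dots> = (\<Sum>D\<in>?I. card (?F D ` ?R D))"
  proof (rule card_UN_disjoint)
    show "\<forall>D\<in>?I. \<forall>E\<in>?I. D \<noteq> E \<longrightarrow> ?F D ` ?R D \<inter> ?F E ` ?R E = {}"
    proof (intro ballI impI equals0I)
      fix D E Z assume DE: "D \<in> ?I" "E \<in> ?I" "D \<noteq> E" and "Z \<in> ?F D ` ?R D \<inter> ?F E ` ?R E"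
      then obtain X Y where "Z = ?F D X" "Z = ?F E Y" by blast
      with DE low[of D X] low[of E Y] show False by simp
    qed
  qed (auto intro!: finite_imageI finite_reps assms)
  also have "\<dots> = (\<Sum>D\<in>?I. card (?R D))"
  proof (rule sum.cong)
    fix D assume D: "D \<in> ?I"
    have "inj_on (?F D) (?R D)"
      by (rule inj_on_inverseI[where g = "\<lambda>Z. {y. q * y \<in> Z}"]) (use D high in auto)
    then show "card (?F D ` ?R D) = card (?R D)" by (rule card_image)
  qed simp
  finally show ?thesis by (simp add: sum.If_cases Int_def)
qed

text \<open>The elements 4, 2, 1 have weights 1, 2, 4, so the eight layers realise each weight
  \<open>d\<close> from 0 to 7 once, by binary expansion; \<open>k\<close>, the size of the layer,
  is the binary digit sum of \<open>d\<close>.\<close>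

lemma card_reps_rec:
  assumes "odd q" "q > 1"
  defines "h \<equiv> \<lambda>s n d k. if d \<le> s \<and> k \<le> n then card (reps q (q * (s - d)) (n - k)) else 0"
  shows "card (reps q s n) =
    h s n 0 0 + h s n 1 1 + h s n 2 1 + h s n 3 2 + h s n 4 1 + h s n 5 2 + h s n 6 2 + h s n 7 3"
proof -
  have "card (reps q s n) = (\<Sum>D\<in>Pow {1, 2, 4}. h s n (weight D) (card D))"
    unfolding h_def by (rule card_reps_rec_Pow[OF assms(1,2)])
  then show ?thesis
    by (simp add: sum_Pow_insert weight_def numeral_2_eq_2[symmetric] numeral_3_eq_3[symmetric])
qed

text \<open>With at least four elements, some element lies outside {1, 2, 4} and is thus divisible
  by \<open>p\<close>; its only possible prime factors are 2 and \<open>q\<close>.\<close>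

lemma reps_prime_unique:
  assumes "prime p" "odd p" "prime q" "odd q" "n \<ge> 4" "X \<in> reps p s n" "X \<in> reps q t n"
  shows "p = q"
proof -
  have "\<not> X \<subseteq> {1, 2, 4}"
  proof
    assume "X \<subseteq> {1, 2, 4}"
    then have "card X \<le> card {1, 2, 4 :: nat}" by (intro card_mono) auto
    with assms(5,6) show False by (simp add: reps_def)
  qed
  then obtain x where x: "x \<in> X" "x \<notin> {1, 2, 4}" by blast
  then have "p dvd x"
    using smooth_cases[of p x] assms(1,6) prime_gt_0_nat by (auto simp: reps_def)
  moreover obtain a b where "x = 2 ^ a * q ^ b"
    using x(1) assms(7) unfolding reps_def smooth_def by blast
  ultimately have "p dvd 2 \<or> p dvd q"
    using assms(1) by (auto simp: prime_dvd_mult_iff dest: prime_dvd_power)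
  then show ?thesis
    using assms(1-4) by (metis primes_dvd_imp_eq two_is_prime_nat)
qed

section \<open>Recurrences for q = 3, 5, 7\<close>

lemma reps_card_0: "s > 0 \<Longrightarrow> reps q s 0 = {}"
  by (auto simp: reps_def recip_sum_def)

text \<open>For q = 3, targets from 11 on are empty, so among the new targets 3(s - d) only 0, 3, 6,
  9 survive. Here d = 6 leads back to 9 and d = 7 leads to 6.\<close>

lemma card_reps_3_9:
  "card (reps 3 9 n) = (if 2 \<le> n then card (reps 3 9 (n - 2)) else 0) +
     (if 3 \<le> n then card (reps 3 6 (n - 3)) else 0)"
  by (cases "n = 0"; cases "n = 1"; cases "n = 2"; subst card_reps_rec;
      simp add: reps_empty reps_0 reps_card_0)

lemma card_reps_3_6:
  "card (reps 3 6 n) = (if n = 2 then 1 else 0) +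
     (if 1 \<le> n then card (reps 3 6 (n - 1)) else 0) +
     (if 2 \<le> n then card (reps 3 3 (n - 2)) + card (reps 3 9 (n - 2)) else 0)"
  by (cases "n = 0"; cases "n = 1"; cases "n = 2"; subst card_reps_rec;
      simp add: reps_empty reps_0 reps_card_0)

text \<open>The term for target 9 has the same size \<open>n\<close>: it comes from the empty layer,
  d = 0. The isolated 1 at n = 2 is the layer {2, 4} of weight 3, which exhausts the target.\<close>

lemma card_reps_3_3:
  "card (reps 3 3 n) = (if n = 2 then 1 else 0) +
     (if 1 \<le> n then card (reps 3 3 (n - 1)) + card (reps 3 6 (n - 1)) else 0) + card (reps 3 9 n)"
  by (cases "n = 0"; cases "n = 1"; cases "n = 2"; subst card_reps_rec;
      simp add: reps_empty reps_0 reps_card_0)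

lemma card_reps_3_4:
  "card (reps 3 4 n) = (if n = 1 then 1 else 0) +
     (if 1 \<le> n then card (reps 3 9 (n - 1)) + card (reps 3 6 (n - 1)) else 0) +
     (if 2 \<le> n then card (reps 3 3 (n - 2)) else 0)"
  by (cases "n = 0"; cases "n = 1"; cases "n = 2"; subst card_reps_rec;
      simp add: reps_empty reps_0 reps_card_0)

text \<open>For q = 5 the bound is 35/4, so the new target is 0 or 5: from 5 via d = 5 or d = 4,
  from 4 via d = 4 or d = 3.\<close>

lemma card_reps_5:
  "card (reps 5 5 n) = (if n = 2 then 1 else 0) + (if 1 \<le> n then card (reps 5 5 (n - 1)) else 0)"
  "card (reps 5 4 n) = (if n = 1 then 1 else 0) + (if 2 \<le> n then card (reps 5 5 (n - 2)) else 0)"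
  by (cases "n = 0"; cases "n = 1"; cases "n = 2"; subst card_reps_rec;
      simp add: reps_empty reps_0 reps_card_0)+

text \<open>For q = 7 the bound is 49/6, so the new target is 0 or 7. Staying at 7 uses the layer
  {1, 2} of weight 6, which makes the recurrence step by 2.\<close>

lemma card_reps_7:
  "card (reps 7 7 n) = (if n = 3 then 1 else 0) + (if 2 \<le> n then card (reps 7 7 (n - 2)) else 0)"
  "card (reps 7 4 n) = (if n = 1 then 1 else 0) + (if 2 \<le> n then card (reps 7 7 (n - 2)) else 0)"
  by (cases "n = 0"; cases "n = 1"; cases "n = 2"; subst card_reps_rec;
      simp add: reps_empty reps_0 reps_card_0)+

section \<open>Restriction to the primes 3, 5, 7\<close>

text \<open>A layer of weight below 4 leaves a target of at least \<open>q\<close>, already beyond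
  the bound because q - 1 is at least 7. A layer of weight 4 leaves target 0, which gives only a
  one-element set.\<close>

lemma reps_ge_11:
  assumes "odd q" "q \<ge> 11" "n \<ge> 2"
  shows "reps q 4 n = {}"
proof -
  have "reps q (q * (4 - weight D)) (n - card D) = {}"
    if D: "D \<subseteq> {1, 2, 4}" "weight D \<le> 4" for D
  proof (cases "weight D = 4")
    case True
    from D have "D \<in> Pow {1, 2, 4}" by simp
    \<comment> \<open>The only subset of {1, 2, 4} of weight 4 is {1}.\<close>
    with True have "card D \<le> 1"
      by (auto simp: Pow_insert weight_def)
    with True show ?thesis using assms by (simp add: reps_0)
  next
    case False
    with D have "q * 1 \<le> q * (4 - weight D)" by (intro mult_le_mono) auto
    with assms have "7 * q \<le> q * (4 - weight D) * (q - 1)"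
      using mult_le_mono[of q "q * (4 - weight D)" 7 "q - 1"] by simp
    then show ?thesis using assms by (intro reps_empty) auto
  qed
  then show ?thesis using assms by (subst reps_rec) auto
qed

lemma prime_odd_less_11:
  fixes q :: nat
  assumes "prime q" "odd q" "q < 11"
  shows "q \<in> {3, 5, 7}"
proof -
  have "q \<noteq> 9"
  proof
    assume "q = 9"
    then have "q = 3 * 3" by simp
    with assms(1) show False using prime_product[of 3 3] by simp
  qed
  moreover have "q = 1 \<or> q = 3 \<or> q = 5 \<or> q = 7 \<or> q = 9"
    using assms(2,3) by presburger
  ultimately show ?thesis using assms(1) by auto
qed

lemma prime_3_5_7: "prime (3::nat)" "prime (5::nat)" "prime (7::nat)"
  by (simp_all add: prime_nat_numeral_eq)

lemma admissible_iff:
  assumes "n \<ge> 2"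
  shows "admissible n X \<longleftrightarrow> X \<in> reps 3 4 n \<or> X \<in> reps 5 4 n \<or> X \<in> reps 7 4 n"
proof
  assume "admissible n X"
  then obtain q where q: "prime q" "odd q" "X \<in> reps q 4 n"
    by (auto simp: admissible_def admissible_with_iff)
  with assms have "q < 11" using reps_ge_11[of q n] by force
  with q prime_odd_less_11[of q] 
  show "X \<in> reps 3 4 n \<or> X \<in> reps 5 4 n \<or> X \<in> reps 7 4 n" by auto
next
  assume "X \<in> reps 3 4 n \<or> X \<in> reps 5 4 n \<or> X \<in> reps 7 4 n"
  then show "admissible n X"
    using assms prime_3_5_7 unfolding admissible_def admissible_with_iff
    by (metis odd_numeral)
qed

section \<open>The explicit sets for q = 5 and q = 7\<close>

lemma smooth_values:
  assumes "q > 0"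
  shows "smooth q (q ^ k)" "smooth q (2 * q ^ k)" "smooth q (4 * q ^ k)" "smooth q 2" "smooth q 4"
proof -
  have *: "smooth q (2 ^ a * q ^ b)" if "a \<in> {0, 1, 2}" for a b
    using that by (auto simp: smooth_def)
  show "smooth q (q ^ k)" "smooth q (2 * q ^ k)" "smooth q (4 * q ^ k)" "smooth q 2" "smooth q 4"
    using *[of 0 k] *[of 1 k] *[of 2 k] *[of 1 0] *[of 2 0] by simp_all
qed

lemma recip_sum_Un:
  "finite A \<Longrightarrow> finite B \<Longrightarrow> A \<inter> B = {} \<Longrightarrow> recip_sum (A \<union> B) = recip_sum A + recip_sum B"
  by (simp add: recip_sum_def sum.union_disjoint)

lemma recip_sum_powers:
  assumes "q > 1" "c > 0"
  shows "recip_sum ((\<lambda>k. c * q ^ k) ` {1..m}) = (1 - 1 / of_nat q ^ m) / (of_nat c * (of_nat q - 1))"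
proof -
  have "recip_sum ((\<lambda>k. c * q ^ k) ` {1..m}) = (\<Sum>k\<in>{1..m}. 1 / of_nat (c * q ^ k))"
    unfolding recip_sum_def using assms by (subst sum.reindex) (auto simp: inj_on_def)
  also have "\<dots> = (1 - 1 / of_nat q ^ m) / (of_nat c * (of_nat q - 1))"
  proof (induction m)
    case (Suc m)
    then have "(\<Sum>k\<in>{1..Suc m}. 1 / of_nat (c * q ^ k) :: rat) =
        (1 - 1 / of_nat q ^ m) / (of_nat c * (of_nat q - 1)) + 1 / of_nat (c * q ^ Suc m)"
      by simp
    also have "\<dots> = (1 - 1 / of_nat q ^ Suc m) / (of_nat c * (of_nat q - 1))"
      using assms by (simp add: divide_simps) (simp add: algebra_simps)
    finally show ?case .
  qed simp
  finally show ?thesis .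
qed

text \<open>The last element closes the geometric series: with m = n - 3, the sum is 3/4 + (1 -
  1/5^m)/4 + 1/(4 5^m) = 1.\<close>

lemma U_in_reps:
  assumes "n \<ge> 4"
  shows "U n \<in> reps 5 4 n"
proof -
  define m where "m = n - 3"
  have m: "n = m + 3" "m \<ge> 1" using assms by (auto simp: m_def)
  define A :: "nat set" where "A = (\<lambda>k. 1 * 5 ^ k) ` {1..m}"
  have U: "U n = {2, 4, 4 * 5 ^ m} \<union> A"
    by (auto simp: U_def A_def m)
  \<comment> \<open>Makes the three even elements 2, 4 and \<open>4 * 5 ^ m\<close> distinct; the
    remaining elements are odd.\<close>
  have "(5::nat) ^ m > 1" using m by (intro one_less_power) auto
  then have ne: "(4::nat) * 5 ^ m \<noteq> 2" "(4::nat) * 5 ^ m \<noteq> 4" by linarith+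
  have odd: "\<forall>x\<in>A. odd x" by (auto simp: A_def)
  then have disj: "{2, 4, 4 * 5 ^ m} \<inter> A = {}" by force
  have "card A = m" by (simp add: A_def card_image inj_on_def)
  with disj ne have "card (U n) = n"
    unfolding U by (subst card_Un_disjoint) (auto simp: A_def m)
  moreover have "recip_sum (U n) = 1"
  proof -
    have "recip_sum (U n) = recip_sum {2, 4, 4 * 5 ^ m} + recip_sum A"
      unfolding U using disj by (intro recip_sum_Un) (auto simp: A_def)
    also have "recip_sum A = (1 - 1 / 5 ^ m) / 4"
      unfolding A_def by (subst recip_sum_powers) auto
    finally show ?thesis using ne by (simp add: recip_sum_def field_simps)
  qed
  ultimately show ?thesis
    using smooth_values[of 5] by (auto simp: reps_def U A_def)
qed

text \<open>The rows \<open>7 ^ k\<close> and \<open>2 * 7 ^ k\<close> together contribute (1/6 +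
  1/12)(1 - 1/7^m), that is (1 - 1/7^m)/4, and the last element supplies the missing 1/(4 7^m). Two
  rows of length m plus three elements force \<open>n\<close> to be odd.\<close>

lemma V_in_reps:
  assumes "n \<ge> 5" "odd n"
  shows "V n \<in> reps 7 4 n"
proof -
  define m where "m = (n - 3) div 2"
  have m: "n = 2 * m + 3" "m \<ge> 1" using assms by (auto simp: m_def elim!: oddE)
  define A :: "nat set" where "A = (\<lambda>k. 1 * 7 ^ k) ` {1..m}"
  define B :: "nat set" where "B = (\<lambda>k. 2 * 7 ^ k) ` {1..m}"
  have V: "V n = {2, 4, 4 * 7 ^ m} \<union> (A \<union> B)"
    by (auto simp: V_def A_def B_def m)
  have "(7::nat) ^ m > 1" using m by (intro one_less_power) auto
  then have ne: "(4::nat) * 7 ^ m \<noteq> 2" "(4::nat) * 7 ^ m \<noteq> 4" by linarith+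
  have A: "\<forall>x\<in>A. odd x" by (auto simp: A_def)
  \<comment> \<open>The power of 2 dividing an element separates the rows from each other and from
    the multiples of 4; being larger than 2 separates this row from the element 2.\<close>
  have B: "\<forall>x\<in>B. even x \<and> x > 2 \<and> \<not> 4 dvd x"
  proof
    fix x assume "x \<in> B"
    then obtain k where k: "k \<ge> 1" "x = 2 * 7 ^ k" by (auto simp: B_def)
    have "(7::nat) ^ k > 1" using k by (intro one_less_power) auto
    moreover have "\<not> 4 dvd x"
    proof
      assume "4 dvd x"
      then have "2 * 2 dvd 2 * (7::nat) ^ k" using k by simp
      then have "even ((7::nat) ^ k)" by (subst (asm) dvd_times_left_cancel_iff) auto
      then show False by simp
    qed
    ultimately show "even x \<and> x > 2 \<and> \<not> 4 dvd x" using k by simp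
  qed
  have fin: "finite A" "finite B" by (auto simp: A_def B_def)
  have AB: "A \<inter> B = {}" using A B by blast
  have disj: "{2, 4, 4 * 7 ^ m} \<inter> (A \<union> B) = {}" using A B by force
  have "card A = m" "card B = m" by (simp_all add: A_def B_def card_image inj_on_def)
  then have "card (V n) = n"
    unfolding V using disj ne fin AB by (subst card_Un_disjoint) (auto simp: card_Un_disjoint m)
  moreover have "recip_sum (V n) = 1"
  proof -
    have "recip_sum (V n) = recip_sum {2, 4, 4 * 7 ^ m} + (recip_sum A + recip_sum B)"
      unfolding V using disj AB fin by (simp only: recip_sum_Un finite_Un finite.intros)
    also have "recip_sum A = (1 - 1 / 7 ^ m) / 6"
      unfolding A_def by (subst recip_sum_powers) auto
    also have "recip_sum B = (1 - 1 / 7 ^ m) / 12"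
      unfolding B_def by (subst recip_sum_powers) auto
    finally show ?thesis using ne by (simp add: recip_sum_def field_simps)
  qed
  ultimately show ?thesis
    using smooth_values[of 7] by (auto simp: reps_def V A_def B_def)
qed

section \<open>Evaluation for sizes 10 to 13\<close>

text \<open>A table of the counts for targets 9, 6, 3, filled in by increasing size; each row
  depends on at most the three preceding ones, apart from the entry for target 3, which also uses
  target 9 in its own row.\<close>

lemma card_reps_3_4_values:
  "card (reps 3 4 10) = 100" "card (reps 3 4 11) = 190"
  "card (reps 3 4 12) = 362" "card (reps 3 4 13) = 690"
proof -
  have 0: "card (reps 3 9 0) = 0" "card (reps 3 6 0) = 0" "card (reps 3 3 0) = 0"
    by (simp_all add: reps_card_0)
  have 1: "card (reps 3 9 (Suc 0)) = 0" "card (reps 3 6 (Suc 0)) = 0" "card (reps 3 3 (Suc 0)) = 0"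
    by (simp_all add: card_reps_3_9[of "Suc 0"] card_reps_3_6[of "Suc 0"] card_reps_3_3[of "Suc 0"] 0)
  have 2: "card (reps 3 9 2) = 0" "card (reps 3 6 2) = 1" "card (reps 3 3 2) = 1"
    by (simp_all add: card_reps_3_9[of 2] card_reps_3_6[of 2] card_reps_3_3[of 2] 0 1)
  have 3: "card (reps 3 9 3) = 0" "card (reps 3 6 3) = 1" "card (reps 3 3 3) = 2"
    by (simp_all add: card_reps_3_9[of 3] card_reps_3_6[of 3] card_reps_3_3[of 3] 0 1 2)
  have 4: "card (reps 3 9 4) = 0" "card (reps 3 6 4) = 2" "card (reps 3 3 4) = 3"
    by (simp_all add: card_reps_3_9[of 4] card_reps_3_6[of 4] card_reps_3_3[of 4] 1 2 3)
  have 5: "card (reps 3 9 5) = 1" "card (reps 3 6 5) = 4" "card (reps 3 3 5) = 6"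
    by (simp_all add: card_reps_3_9[of 5] card_reps_3_6[of 5] card_reps_3_3[of 5] 2 3 4)
  have 6: "card (reps 3 9 6) = 1" "card (reps 3 6 6) = 7" "card (reps 3 3 6) = 11"
    by (simp_all add: card_reps_3_9[of 6] card_reps_3_6[of 6] card_reps_3_3[of 6] 3 4 5)
  have 7: "card (reps 3 9 7) = 3" "card (reps 3 6 7) = 14" "card (reps 3 3 7) = 21"
    by (simp_all add: card_reps_3_9[of 7] card_reps_3_6[of 7] card_reps_3_3[of 7] 4 5 6)
  have 8: "card (reps 3 9 8) = 5" "card (reps 3 6 8) = 26" "card (reps 3 3 8) = 40"
    by (simp_all add: card_reps_3_9[of 8] card_reps_3_6[of 8] card_reps_3_3[of 8] 5 6 7)
  have 9: "card (reps 3 9 9) = 10" "card (reps 3 6 9) = 50" "card (reps 3 3 9) = 76"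
    by (simp_all add: card_reps_3_9[of 9] card_reps_3_6[of 9] card_reps_3_3[of 9] 6 7 8)
  have 10: "card (reps 3 9 10) = 19" "card (reps 3 6 10) = 95" "card (reps 3 3 10) = 145"
    by (simp_all add: card_reps_3_9[of 10] card_reps_3_6[of 10] card_reps_3_3[of 10] 7 8 9)
  have 11: "card (reps 3 9 11) = 36" "card (reps 3 6 11) = 181" "card (reps 3 3 11) = 276"
    by (simp_all add: card_reps_3_9[of 11] card_reps_3_6[of 11] card_reps_3_3[of 11] 8 9 10)
  have 12: "card (reps 3 9 12) = 69" "card (reps 3 6 12) = 345" "card (reps 3 3 12) = 526"
    by (simp_all add: card_reps_3_9[of 12] card_reps_3_6[of 12] card_reps_3_3[of 12] 9 10 11)
  show "card (reps 3 4 10) = 100" "card (reps 3 4 11) = 190"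
    "card (reps 3 4 12) = 362" "card (reps 3 4 13) = 690"
    by (simp_all add: card_reps_3_4 8 9 10 11 12)
qed

text \<open>From size 2 on, the recurrence for target 5 just carries the value 1 along.\<close>

lemma card_reps_5_4: "n \<in> {10, 11, 12, 13} \<Longrightarrow> card (reps 5 4 n) = 1"
  by (elim insertE emptyE; hypsubst; simp add: card_reps_5 del: One_nat_def)

text \<open>For target 7 the count is 1 at size 3 and is copied in steps of 2, so only odd sizes are
  reached.\<close>

lemma card_reps_7_4:
  "n \<in> {10, 11, 12, 13} \<Longrightarrow> card (reps 7 4 n) = (if n \<in> {11, 13} then 1 else 0)"
  by (elim insertE emptyE; hypsubst; simp add: card_reps_7 del: One_nat_def)

lemma reps_5_eq:
  assumes "n \<in> {10, 11, 12, 13}"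
  shows "reps 5 4 n = {U n}"
proof -
  have "U n \<in> reps 5 4 n" using assms by (intro U_in_reps) auto
  with card_reps_5_4[OF assms] show ?thesis by (auto simp: card_1_singleton_iff)
qed

lemma reps_7_eq:
  assumes "n \<in> {10, 11, 12, 13}"
  shows "reps 7 4 n = (if n \<in> {11, 13} then {V n} else {})"
proof (cases "n \<in> {11, 13}")
  case True
  then have "V n \<in> reps 7 4 n" by (intro V_in_reps) auto
  moreover from True have "card (reps 7 4 n) = 1" using card_reps_7_4[OF assms] by simp
  ultimately show ?thesis using True by (auto simp: card_1_singleton_iff)
next
  case False
  \<comment> \<open>Finiteness is essential here, since an infinite set also has \<open>card\<close>
    equal to 0.\<close>
  then show ?thesis using card_reps_7_4[OF assms] finite_reps[of 7 4 n] by auto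
qed

lemma admissible_with_unique:
  assumes "admissible_with p n X" "admissible_with q n X" "n \<ge> 4"
  shows "p = q"
  using assms reps_prime_unique[of p q n X 4 4] by (auto simp: admissible_with_iff)

text \<open>The families for q = 3, 5, 7 are disjoint by uniqueness of the prime; q = 5 adds one
  set, and q = 7 adds one more for n = 11 and n = 13.\<close>

lemma card_admissible:
  assumes n: "n \<in> {10, 11, 12, 13}"
  shows "card {X. admissible n X} = card (reps 3 4 n) + (if n \<in> {11, 13} then 2 else 1)"
proof -
  have eq: "{X. admissible n X} = reps 3 4 n \<union> (reps 5 4 n \<union> reps 7 4 n)"
    using admissible_iff[of n] n by auto
  have disj: "reps p 4 n \<inter> reps q 4 n = {}" if "p \<in> {3, 5, 7}" "q \<in> {3, 5, 7}" "p \<noteq> q" for p q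
  proof (rule equals0I)
    fix X assume "X \<in> reps p 4 n \<inter> reps q 4 n"
    moreover have "prime p" "prime q" "odd p" "odd q" using that(1,2) prime_3_5_7 by auto
    ultimately show False using reps_prime_unique[of p q n X 4 4] n that(3) by auto
  qed
  have "card {X. admissible n X} = card (reps 3 4 n) + (card (reps 5 4 n) + card (reps 7 4 n))"
    using disj[of 3 5] disj[of 3 7] disj[of 5 7] unfolding eq
    by (simp add: card_Un_disjoint finite_reps Int_Un_distrib)
  then show ?thesis using card_reps_5_4[OF n] card_reps_7_4[OF n] by simp
qed

theorem theorem3:
  shows "(card {X. admissible 10 X} = 101 \<and>
          card {X. admissible 11 X} = 192 \<and>
          card {X. admissible 12 X} = 363 \<and>
          card {X. admissible 13 X} = 692) \<and>
         (card {X. admissible_with 3 10 X} = 100 \<and>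
          card {X. admissible_with 3 11 X} = 190 \<and>
          card {X. admissible_with 3 12 X} = 362 \<and>
          card {X. admissible_with 3 13 X} = 690) \<and>
         (\<forall>n\<in>{10, 11, 12, 13}.
            {X. admissible n X \<and> \<not> admissible_with 3 n X} =
              {U n} \<union> (if n \<in> {11, 13} then {V n} else {})) \<and>
         (\<forall>n\<in>{10, 11, 12, 13}. \<forall>q. admissible_with q n (U n) \<longleftrightarrow> q = 5) \<and>
         (\<forall>n\<in>{11, 13}. \<forall>q. admissible_with q n (V n) \<longleftrightarrow> q = 7)"
proof -
  let ?N = "{10, 11, 12, 13} :: nat set"
  have with_3: "admissible_with 3 n X \<longleftrightarrow> X \<in> reps 3 4 n" if "n \<in> ?N" for n X
    using that prime_3_5_7 by (auto simp: admissible_with_iff)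
  have U: "admissible_with 5 n (U n)" if "n \<in> ?N" for n
    using that prime_3_5_7 U_in_reps[of n] by (auto simp: admissible_with_iff)
  have V: "admissible_with 7 n (V n)" if "n \<in> {11, 13}" for n
    using that prime_3_5_7 V_in_reps[of n] by (auto simp: admissible_with_iff)
  have others: "{X. admissible n X \<and> \<not> admissible_with 3 n X} =
      {U n} \<union> (if n \<in> {11, 13} then {V n} else {})" if n: "n \<in> ?N" for n
  proof -
    have "n \<ge> 4" using n by auto
    \<comment> \<open>A set of at least four elements determines its prime, and that of
      \<open>U n\<close> is 5; likewise 7 for \<open>V n\<close> below.\<close>
    have "\<not> admissible_with 3 n (U n)"
      using admissible_with_unique[OF _ U[OF n] \<open>n \<ge> 4\<close>, of 3] by auto
    moreover have "\<not> admissible_with 3 n (V n)" if "n \<in> {11, 13}"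
      using admissible_with_unique[OF _ V[OF that] \<open>n \<ge> 4\<close>, of 3] by auto
    ultimately show ?thesis
      using admissible_iff[of n] with_3[OF n] reps_5_eq[OF n] reps_7_eq[OF n] \<open>n \<ge> 4\<close>
      by (auto split: if_splits)
  qed
  have U_iff: "admissible_with q n (U n) \<longleftrightarrow> q = 5" if "n \<in> ?N" for n q
    using admissible_with_unique[OF _ U[OF that], of q] U[OF that] that by auto
  have V_iff: "admissible_with q n (V n) \<longleftrightarrow> q = 7" if "n \<in> {11, 13}" for n q
    using admissible_with_unique[OF _ V[OF that], of q] V[OF that] that by auto
  have "card {X. admissible 10 X} = 101 \<and> card {X. admissible 11 X} = 192 \<and>
      card {X. admissible 12 X} = 363 \<and> card {X. admissible 13 X} = 692"
    by (simp add: card_admissible card_reps_3_4_values)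
  moreover have "card {X. admissible_with 3 10 X} = 100 \<and> card {X. admissible_with 3 11 X} = 190 \<and>
      card {X. admissible_with 3 12 X} = 362 \<and> card {X. admissible_with 3 13 X} = 690"
    by (simp add: with_3 card_reps_3_4_values)
  moreover have "\<forall>n\<in>?N. {X. admissible n X \<and> \<not> admissible_with 3 n X} =
      {U n} \<union> (if n \<in> {11, 13} then {V n} else {})"
    by (intro ballI others)
  moreover have "\<forall>n\<in>?N. \<forall>q. admissible_with q n (U n) \<longleftrightarrow> q = 5"
    by (intro ballI allI U_iff)
  moreover have "\<forall>n\<in>{11, 13}. \<forall>q. admissible_with q n (V n) \<longleftrightarrow> q = 7"
    by (intro ballI allI V_iff)
  ultimately show ?thesis by - (elim conjE, intro conjI)
qed

end
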